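(* For all positive integers $n$ and $k$, $$p(n,k)=\sum_{d\mid n}\ \sum_{i_0=1}^{\lfloor d/k\rfloor}\ \sum_{i_1=i_0}^{\lfloor\frac{d-i_0}{k-1}\rfloor}\ \sum_{i_2=i_1}^{\lfloor\frac{d-i_0-i_1}{k-2}\rfloor}\cdots\sum_{i_{k-3}=i_{k-4}}^{\lfloor\frac{d-i_0-i_1-i_2-\cdots-i_{k-4}}{3}\rfloor}\ \sum_{c\mid (d,i_0,i_1,i_2,\ldots,i_{k-3})}\mu(c)\left(\left\lfloor\frac{d-i_0-i_1-i_2-\cdots-i_{k-3}}{2c}\right\rfloor-\left\lfloor\frac{i_{k-3}-1}{c}\right\rfloor\right).$$
   Context: $p(n,k)$ is the number of partitions of the positive integer $n$ into exactly $k$ parts (it is $0$ if $k>n$). $\lfloor x\rfloor$ is the floor of $x$, $\mu$ is the Möbius function, and $(d,i_0,i_1,i_2,\ldots,i_{k-3})$ denotes the greatest common divisor. Divisors are positive.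
   Formalization: Proved for k ≥ 2 rather than all positive k: for k = 1 the formula is undefined, as it refers to i_{-2} (and with no sums and i = 1 it gives 0 ≠ p(1,1) = 1). For k = 2 there are no sums over i and the remaining symbol i_{-1} is read as 1. *)

theory Defs
  imports
    "HOL-Library.Multiset"
    "HOL-Computational_Algebra.Computational_Algebra"
begin

definition partitions_into :: "nat \<Rightarrow> nat \<Rightarrow> nat multiset set" where
  "partitions_into n k = {M. 0 \<notin># M \<and> size M = k \<and> sum_mset M = n}"

definition num_partitions :: "nat \<Rightarrow> nat \<Rightarrow> nat" where
  "num_partitions n k = card (partitions_into n k)"

definition moebius :: "nat \<Rightarrow> int" where
  "moebius n = (if squarefree n then (-1) ^ card (prime_factors n) else 0)"

(* last_index [i_0, ..., i_j] = i_j.  On the empty list it is 1, the lower limit of the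
   outermost summation, so that last_index is the lower limit of every summation.
   For k = 2 there are no summation indices and i_(k-3) is read as this 1; for k = 1 the formula
   (with "-1" summations) has no meaning. *)
definition last_index :: "int list \<Rightarrow> int" where
  "last_index is = (if is = [] then 1 else last is)"

(* The list "is" holds the indices i_0, ..., i_(j-1) bound by the outer summations, so j = length is.
   m further summations follow, the next one being
     i_j = i_(j-1), ..., floor ((d - i_0 - ... - i_(j-1)) / (k - j)),
   and F is the summand, a function of the full list of indices.
   On int, div is the floor of the quotient, and {a..b} is empty for b < a. *)
primrec nested_sum :: "nat \<Rightarrow> nat \<Rightarrow> (int list \<Rightarrow> int) \<Rightarrow> nat \<Rightarrow> int list \<Rightarrow> int" where
  "nested_sum d k F 0 is = F is"
| "nested_sum d k F (Suc m) is =
     (\<Sum>i = last_index is..(int d - sum_list is) div (int k - int (length is)).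
        nested_sum d k F m (is @ [i]))"

end

theory Submission
  imports Defs
begin

text \<open>
  Write a partition as its nondecreasing list of parts. Dividing all parts of a partition of
  \<open>n\<close> by their greatest common divisor \<open>n div d\<close> gives a partition of the divisor \<open>d\<close> of \<open>n\<close>
  whose parts have greatest common divisor 1, and every such partition of \<open>d\<close> arises exactly
  once (\<open>card_bounded_partitions_eq_sum_divisors\<close>). So it suffices that, for each \<open>d\<close>, the nested
  sum counts the partitions of \<open>d\<close> into \<open>k\<close> parts with greatest common divisor 1
  (\<open>nested_sum_eq_card\<close>).

  The summation indices \<open>i\<^sub>0 \<le> \<dots> \<le> i\<^bsub>k-3\<^esub>\<close> are the \<open>k - 2\<close> smallest parts: a part
  followed by \<open>m\<close> parts that are at least as large is at most the remaining total divided by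
  \<open>m + 1\<close>, which is the upper limit of its summation. Once these parts are chosen, let \<open>s\<close> be the
  remaining total and \<open>g\<close> the greatest common divisor of \<open>d\<close> and the chosen parts. The last two
  parts, in increasing order, are \<open>a\<close> and \<open>s - a\<close>, where \<open>i\<^bsub>k-3\<^esub> \<le> a \<le> s div 2\<close>, and since
  \<open>g\<close> divides \<open>s\<close> all parts together have greatest common divisor 1 iff \<open>a\<close> is coprime to \<open>g\<close>. Moebius inversion over the
  divisors of \<open>g\<close> counts these \<open>a\<close> (\<open>card_coprime_greaterThanAtMost\<close>), and the result is the
  innermost sum. For \<open>k = 2\<close> there are no chosen parts and the lower bound for \<open>a\<close> is 1.
\<close>

section \<open>The Moebius function and counting coprime integers\<close>

lemma sum_Pow_neg_one_power_card:
  assumes "finite A"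
  shows "(\<Sum>X\<in>Pow A. (-1) ^ card X) = (if A = {} then 1 else 0 :: int)"
proof -
  have "(\<Sum>X\<in>Pow A. (-1) ^ card X) = (\<Prod>x\<in>A. (-1) + (1::int))"
    by (subst prod_add [OF assms]) simp
  then show ?thesis
    using assms by auto
qed

lemma prod_prime_factors_squarefree:
  fixes c :: nat
  assumes "squarefree c"
  shows "\<Prod>(prime_factors c) = c"
proof -
  have c: "c \<noteq> 0" using assms by (cases "c = 0") simp_all
  have "(\<Prod>p\<in>prime_factors c. p ^ multiplicity p c) = \<Prod>(prime_factors c)"
    using assms c by (intro prod.cong) (simp_all add: squarefree_factorial_semiring')
  then show ?thesis
    using prod_prime_factors [OF c] by simp
qed

text \<open>
  Only squarefree divisors contribute, and these correspond to the sets of prime factors of \<open>n\<close>;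
  so the sum is an alternating sum over a power set.
\<close>

lemma sum_moebius_divisors:
  assumes "n > 0"
  shows "(\<Sum>c | c dvd n. moebius c) = (if n = 1 then 1 else 0)"
proof -
  have fin: "finite {c. c dvd n}" using assms by simp
  have "(\<Sum>c | c dvd n. moebius c) = (\<Sum>c | c dvd n \<and> squarefree c. (-1) ^ card (prime_factors c))"
    by (rule sum.mono_neutral_cong_right) (use fin in \<open>auto simp: moebius_def\<close>)
  also have "\<dots> = (\<Sum>X\<in>Pow (prime_factors n). (-1) ^ card X)"
  proof (rule sum.reindex_bij_witness [where i = Prod and j = prime_factors])
    fix c assume c: "c \<in> {c. c dvd n \<and> squarefree c}"
    show "\<Prod>(prime_factors c) = c"
      using c by (simp add: prod_prime_factors_squarefree)
    show "prime_factors c \<in> Pow (prime_factors n)"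
      using c assms by (auto simp: in_prime_factors_iff intro: dvd_trans)
  next
    fix X assume X: "X \<in> Pow (prime_factors n)"
    then have fX: "finite X" and pX: "\<And>p. p \<in> X \<Longrightarrow> prime p" and dX: "\<And>p. p \<in> X \<Longrightarrow> p dvd n"
      using finite_subset by (auto simp: in_prime_factors_iff)
    show "prime_factors (\<Prod>X) = X"
      using prime_factorization_prod_mset_primes [of "mset_set X"] fX pX
      by (simp add: prod_unfold_prod_mset)
    have cop: "coprime p q" if "p \<in> X" "q \<in> X" "p \<noteq> q" for p q
      using that pX primes_coprime by blast
    have "squarefree (\<Prod>X)"
      using squarefree_prod_coprime [of X "\<lambda>p. p"] cop pX squarefree_prime by blast
    moreover have "\<Prod>X dvd n"
      using fX cop dX
    proof (induction X rule: finite_induct)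
      case (insert p X)
      have "coprime p (\<Prod>X)"
        using insert by (intro prod_coprime_right) auto
      then show ?case
        using insert by (auto intro: divides_mult)
    qed auto
    ultimately show "\<Prod>X \<in> {c. c dvd n \<and> squarefree c}" by simp
  qed simp
  also have "\<dots> = (if prime_factors n = {} then 1 else 0)"
    by (rule sum_Pow_neg_one_power_card) simp
  also have "prime_factors n = {} \<longleftrightarrow> n = 1"
    using assms by (auto simp: prime_factorization_empty_iff)
  finally show ?thesis .
qed

lemma le_div_iff_mult_le_int:
  fixes m n c :: int
  assumes "c > 0"
  shows "m \<le> n div c \<longleftrightarrow> m * c \<le> n"
proof
  assume "m \<le> n div c"
  then have "m * c \<le> n div c * c"
    using assms by simp
  also have "\<dots> \<le> n"
    using assms div_mult_mod_eq [of n c] pos_mod_sign [of c n] by linarith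
  finally show "m * c \<le> n" .
next
  assume "m * c \<le> n"
  then show "m \<le> n div c"
    using assms zdiv_mono1 [of "m * c" n c] by simp
qed

lemma card_multiples_greaterThanAtMost:
  fixes A B c :: int
  assumes "A \<le> B" "c > 0"
  shows "int (card {a \<in> {A<..B}. c dvd a}) = B div c - A div c"
proof -
  have "{a \<in> {A<..B}. c dvd a} = (*) c ` {A div c<..B div c}"
  proof -
    have div_iff: "A div c < q \<and> q \<le> B div c \<longleftrightarrow> A < c * q \<and> c * q \<le> B" for q
      using assms le_div_iff_mult_le_int [of c q A] le_div_iff_mult_le_int [of c q B]
      by (auto simp: mult.commute not_le [symmetric])
    show ?thesis
    proof (intro set_eqI iffI)
      fix a assume a: "a \<in> {a \<in> {A<..B}. c dvd a}"
      then have "c dvd a" by simp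
      then obtain q where "a = c * q" by (rule dvdE)
      with a show "a \<in> (*) c ` {A div c<..B div c}"
        using div_iff [of q] by (intro image_eqI [of _ _ q]) simp_all
    next
      fix a assume "a \<in> (*) c ` {A div c<..B div c}"
      then obtain q where "a = c * q" and q: "q \<in> {A div c<..B div c}"
        by (rule imageE)
      then show "a \<in> {a \<in> {A<..B}. c dvd a}"
        using div_iff [of q] by simp
    qed
  qed
  moreover have "inj_on ((*) c) {A div c<..B div c}"
    using assms by (auto simp: inj_on_def)
  moreover have "A div c \<le> B div c"
    using assms by (simp add: zdiv_mono1)
  ultimately show ?thesis
    by (simp add: card_image)
qed

lemma card_coprime_greaterThanAtMost:
  fixes A B g :: int
  assumes "A \<le> B" "g > 0"
  shows "int (card {a \<in> {A<..B}. coprime a g}) =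
    (\<Sum>c | int c dvd g. moebius c * (B div int c - A div int c))"
proof -
  have div_eq: "{c. int c dvd h} = {c. c dvd nat h}" if "h > 0" for h
    using that by (auto simp: int_dvd_int_iff [symmetric])
  have fin: "finite {c. int c dvd g}"
    using assms by (simp add: div_eq)
  have pos: "int c > 0" if "int c dvd g" for c
    using that assms by (cases c) auto
  \<comment> \<open>Moebius inversion: the indicator of coprimality as a sum over the common divisors.\<close>
  have ind: "(if coprime a g then 1 else 0) =
      (\<Sum>c | int c dvd g. if int c dvd a then moebius c else 0)" for a
  proof -
    have pos_gcd: "gcd a g > 0" using assms by simp
    then have "(\<Sum>c | int c dvd gcd a g. moebius c) = (if nat (gcd a g) = 1 then 1 else 0)"
      unfolding div_eq [OF pos_gcd] by (intro sum_moebius_divisors) simp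
    also have "nat (gcd a g) = 1 \<longleftrightarrow> coprime a g"
      by (auto simp: coprime_iff_gcd_eq_1)
    finally have "(if coprime a g then 1 else 0) =
        (\<Sum>c | int c dvd g \<and> int c dvd a. moebius c)"
      by (simp add: conj_commute)
    also have "\<dots> = (\<Sum>c\<in>{c. int c dvd g}. if int c dvd a then moebius c else 0)"
      using sum.inter_filter [OF fin, of moebius "\<lambda>c. int c dvd a"] by simp
    finally show ?thesis .
  qed
  have "int (card {a \<in> {A<..B}. coprime a g}) = (\<Sum>a\<in>{A<..B}. if coprime a g then 1 else 0)"
    by (subst sum.inter_filter [symmetric]) auto
  also have "\<dots> = (\<Sum>a\<in>{A<..B}. \<Sum>c | int c dvd g. if int c dvd a then moebius c else 0)"
    by (simp only: ind)
  also have "\<dots> = (\<Sum>c | int c dvd g. \<Sum>a\<in>{A<..B}. if int c dvd a then moebius c else 0)"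
    by (rule sum.swap)
  also have "\<dots> = (\<Sum>c | int c dvd g. moebius c * (B div int c - A div int c))"
  proof (rule sum.cong [OF refl])
    fix c assume "c \<in> {c. int c dvd g}"
    then have "int (card {a \<in> {A<..B}. int c dvd a}) = B div int c - A div int c"
      using assms pos by (intro card_multiples_greaterThanAtMost) auto
    moreover have "(\<Sum>a\<in>{A<..B}. if int c dvd a then moebius c else 0) =
        moebius c * int (card {a \<in> {A<..B}. int c dvd a})"
      by (subst sum.inter_filter [symmetric]) auto
    ultimately show "(\<Sum>a\<in>{A<..B}. if int c dvd a then moebius c else 0) =
        moebius c * (B div int c - A div int c)" by simp
  qed
  finally show ?thesis .
qed

section \<open>Partitions as sorted lists\<close>

text \<open>
  The partitions of \<open>s\<close> into \<open>m\<close> parts that are all at least \<open>l\<close>, each written as the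
  nondecreasing list of its parts. The lower bound is encoded by requiring that \<open>l # ys\<close> is sorted.
\<close>

definition bounded_partitions :: "int \<Rightarrow> nat \<Rightarrow> int \<Rightarrow> int list set" where
  "bounded_partitions l m s = {ys. length ys = m \<and> sorted (l # ys) \<and> sum_list ys = s}"

lemma Gcd_dvd_sum_list:
  fixes xs :: "int list"
  shows "Gcd (set xs) dvd sum_list xs"
proof -
  have "g dvd sum_list xs" if "\<forall>x\<in>set xs. g dvd x" for g :: int
    using that by (induction xs) auto
  then show ?thesis by simp
qed

lemma length_mult_le_sum_list:
  fixes l :: int
  assumes "\<forall>y\<in>set ys. l \<le> y"
  shows "int (length ys) * l \<le> sum_list ys"
  using assms by (induction ys) (auto simp: algebra_simps)

lemma finite_bounded_partitions:
  assumes "l \<ge> 0"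
  shows "finite (bounded_partitions l m s)"
proof (rule finite_subset)
  show "bounded_partitions l m s \<subseteq> {ys. set ys \<subseteq> {0..s} \<and> length ys = m}"
  proof clarify
    fix ys assume "ys \<in> bounded_partitions l m s"
    then have ys: "length ys = m" "sum_list ys = s" "\<And>y. y \<in> set ys \<Longrightarrow> 0 \<le> y"
      using assms by (auto simp: bounded_partitions_def)
    have "y \<le> s" if "y \<in> set ys" for y
    proof -
      obtain us vs where "ys = us @ y # vs"
        using \<open>y \<in> set ys\<close> split_list by metis
      moreover have "sum_list us \<ge> 0" "sum_list vs \<ge> 0"
        using ys calculation by (auto intro!: sum_list_nonneg)
      ultimately show ?thesis
        using ys by simp
    qed
    then show "set ys \<subseteq> {0..s} \<and> length ys = m"
      using ys by auto
  qed
  show "finite {ys. set ys \<subseteq> {0..s} \<and> length ys = m}"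
    by (rule finite_lists_length_eq) simp
qed

lemma bounded_partitions_Suc:
  "bounded_partitions l (Suc m) s =
    (\<Union>i\<in>{l..s div int (Suc m)}. (#) i ` bounded_partitions i m (s - i))"
proof (intro set_eqI iffI)
  fix zs assume "zs \<in> bounded_partitions l (Suc m) s"
  then obtain i ys where zs: "zs = i # ys" and ys: "ys \<in> bounded_partitions i m (s - i)"
    and "l \<le> i"
    by (cases zs) (auto simp: bounded_partitions_def)
  moreover have "i \<le> s div int (Suc m)"
    using length_mult_le_sum_list [of ys i] ys
    by (auto simp: bounded_partitions_def le_div_iff_mult_le_int algebra_simps)
  ultimately show "zs \<in> (\<Union>i\<in>{l..s div int (Suc m)}. (#) i ` bounded_partitions i m (s - i))"
    by auto
next
  fix zs assume "zs \<in> (\<Union>i\<in>{l..s div int (Suc m)}. (#) i ` bounded_partitions i m (s - i))"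
  then obtain i ys where "zs = i # ys" "ys \<in> bounded_partitions i m (s - i)" "l \<le> i"
    by auto
  then show "zs \<in> bounded_partitions l (Suc m) s"
    by (auto simp: bounded_partitions_def intro: order_trans)
qed

text \<open>
  The partitions as above in which the parts and \<open>g\<close> have greatest common divisor 1.
  In the nested sum for \<open>d\<close>, the parameter \<open>g\<close> is the greatest common divisor of \<open>d\<close> and the
  parts that have already been chosen, so that coprimality can be stated for the remaining parts.
\<close>

definition coprime_partitions :: "int \<Rightarrow> int \<Rightarrow> nat \<Rightarrow> int \<Rightarrow> int list set" where
  "coprime_partitions g l m s = {ys \<in> bounded_partitions l m s. coprime g (Gcd (set ys))}"

lemma coprime_partitions_Suc:
  "coprime_partitions g l (Suc m) s =
    (\<Union>i\<in>{l..s div int (Suc m)}. (#) i ` coprime_partitions (gcd g i) i m (s - i))"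
proof -
  have "coprime g (Gcd (set (i # ys))) \<longleftrightarrow> coprime (gcd g i) (Gcd (set ys))" for i ys
    by (simp add: coprime_iff_gcd_eq_1 gcd.assoc)
  then show ?thesis
    by (auto simp: coprime_partitions_def bounded_partitions_Suc)
qed

lemma card_coprime_partitions_Suc:
  assumes "l \<ge> 0"
  shows "card (coprime_partitions g l (Suc m) s) =
    (\<Sum>i = l..s div int (Suc m). card (coprime_partitions (gcd g i) i m (s - i)))"
proof -
  have "finite (coprime_partitions (gcd g i) i m (s - i))" if "i \<ge> l" for i
    using finite_bounded_partitions [of i m "s - i"] assms that
    by (auto simp: coprime_partitions_def)
  then show ?thesis
    unfolding coprime_partitions_Suc
    by (subst card_UN_disjoint) (auto simp: card_image)
qed

text \<open>
  The hypothesis \<open>l - 1 \<le> s div 2\<close> ensures that the differences of floors are cardinalities even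
  when the range of the smaller part is empty.
\<close>

lemma card_coprime_partitions_2:
  assumes "g > 0" "g dvd s" "l \<ge> 0" "l - 1 \<le> s div 2"
  shows "int (card (coprime_partitions g l 2 s)) =
    (\<Sum>c | int c dvd g. moebius c * (s div (2 * int c) - (l - 1) div int c))"
proof -
  have "coprime_partitions g l 2 s =
      (\<lambda>a. [a, s - a]) ` {a \<in> {l - 1<..s div 2}. coprime a g}"
  proof -
    \<comment> \<open>As \<open>g\<close> divides \<open>s\<close>, the second part adds no condition to the first.\<close>
    have gcd_eq: "gcd g (gcd a (s - a)) = gcd g a" for a
    proof -
      have "gcd g a dvd s - a"
        using assms by (meson dvd_diff dvd_trans gcd_dvd1 gcd_dvd2)
      then have "gcd (gcd g a) (s - a) = gcd g a"
        by (simp add: gcd_proj1_iff)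
      then show ?thesis by (simp add: gcd.assoc)
    qed
    have coprime_iff: "coprime g (Gcd (set [a, s - a])) \<longleftrightarrow> coprime a g" for a
      using gcd_eq [of a] by (simp add: coprime_iff_gcd_eq_1 gcd.commute [of a g])
    have length_2: "length ys = 2 \<longleftrightarrow> (\<exists>a b. ys = [a, b])" for ys :: "int list"
      by (auto simp: length_Suc_conv numeral_2_eq_2)
    have "ys \<in> coprime_partitions g l 2 s \<longleftrightarrow>
        (\<exists>a. ys = [a, s - a] \<and> l \<le> a \<and> a \<le> s - a \<and> coprime g (Gcd (set [a, s - a])))" for ys
    proof
      assume ys: "ys \<in> coprime_partitions g l 2 s"
      then obtain a b where "ys = [a, b]"
        unfolding coprime_partitions_def bounded_partitions_def length_2 by blast
      moreover from this have "b = s - a" "l \<le> a" "a \<le> b"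
        using ys by (simp_all add: coprime_partitions_def bounded_partitions_def)
      ultimately show "\<exists>a. ys = [a, s - a] \<and> l \<le> a \<and> a \<le> s - a \<and> coprime g (Gcd (set [a, s - a]))"
        using ys unfolding coprime_partitions_def by blast
    qed (auto simp: coprime_partitions_def bounded_partitions_def)
    moreover have "l \<le> a \<and> a \<le> s - a \<longleftrightarrow> a \<in> {l - 1<..s div 2}" for a
      by auto
    ultimately show ?thesis
      unfolding coprime_iff by blast
  qed
  then have "card (coprime_partitions g l 2 s) = card {a \<in> {l - 1<..s div 2}. coprime a g}"
    by (simp add: card_image inj_on_def)
  also have "int \<dots> = (\<Sum>c | int c dvd g. moebius c * (s div 2 div int c - (l - 1) div int c))"
    using assms by (intro card_coprime_greaterThanAtMost) auto
  finally show ?thesis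
    by (simp add: zdiv_zmult2_eq)
qed

section \<open>The nested sum counts partitions with coprime parts\<close>

text \<open>
  Here \<open>is\<close> is the list of parts already chosen and \<open>m\<close> the number of summations left, so that
  \<open>m + 2\<close> parts are still to be chosen. The bound on \<open>last_index is - 1\<close> is an invariant of the
  summation ranges that yields the hypothesis of \<open>card_coprime_partitions_2\<close> in the innermost
  summand. The natural bound \<open>last_index is * int (m + 2) \<le> int d - sum_list is\<close> would not do:
  for \<open>is = []\<close> it says \<open>k \<le> d\<close>, which may fail for small divisors \<open>d\<close> of \<open>n\<close>.
\<close>

lemma nested_sum_eq_card:
  assumes "d > 0" "length is + m + 2 = k" "last_index is \<ge> 1"
    and "(last_index is - 1) * int (m + 2) \<le> int d - sum_list is"
  shows "nested_sum d k
         (\<lambda>is. \<Sum>c | int c dvd Gcd (set (int d # is)).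
            moebius c * ((int d - sum_list is) div (2 * int c) - (last_index is - 1) div int c))
         m is =
    int (card (coprime_partitions (Gcd (set (int d # is))) (last_index is) (m + 2)
      (int d - sum_list is)))"
  using assms(2-)
proof (induction m arbitrary: "is")
  case 0
  have "Gcd (set (int d # is)) > 0"
    using assms(1) by simp
  moreover have "Gcd (set (int d # is)) dvd int d - sum_list is"
    using Gcd_dvd_sum_list [of "is"] by (auto intro: dvd_diff dvd_trans)
  moreover have "last_index is - 1 \<le> (int d - sum_list is) div 2"
    using 0 by simp
  ultimately have "int (card (coprime_partitions (Gcd (set (int d # is))) (last_index is) 2
        (int d - sum_list is))) =
      (\<Sum>c | int c dvd Gcd (set (int d # is)). moebius c *
        ((int d - sum_list is) div (2 * int c) - (last_index is - 1) div int c))"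
    by (intro card_coprime_partitions_2) (use 0 in simp_all)
  then show ?case
    by (simp only: nested_sum.simps add_0)
next
  case (Suc m)
  let ?F = "\<lambda>is. \<Sum>c | int c dvd Gcd (set (int d # is)).
    moebius c * ((int d - sum_list is) div (2 * int c) - (last_index is - 1) div int c)"
  let ?s = "int d - sum_list is"
  have parts_left: "int k - int (length is) = int (Suc (m + 2))"
    using Suc.prems by simp
  have "nested_sum d k ?F (Suc m) is =
      (\<Sum>i = last_index is..?s div int (Suc (m + 2)). nested_sum d k ?F m (is @ [i]))"
    unfolding nested_sum.simps parts_left ..
  also have "\<dots> = (\<Sum>i = last_index is..?s div int (Suc (m + 2)).
      int (card (coprime_partitions (gcd (Gcd (set (int d # is))) i) i (m + 2) (?s - i))))"
  proof (rule sum.cong [OF refl])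
    fix i assume i: "i \<in> {last_index is..?s div int (Suc (m + 2))}"
    have last: "last_index (is @ [i]) = i"
      by (simp add: last_index_def)
    have Gcd_eq: "Gcd (set (int d # is @ [i])) = gcd (Gcd (set (int d # is))) i"
      by (simp add: gcd.assoc gcd.commute gcd.left_commute)
    have "i * int (Suc (m + 2)) \<le> ?s"
      using i by (simp add: le_div_iff_mult_le_int mult.commute del: of_nat_Suc)
    then have "(i - 1) * int (m + 2) \<le> ?s - i"
      by (simp add: algebra_simps)
    then have "nested_sum d k ?F m (is @ [i]) =
        int (card (coprime_partitions (Gcd (set (int d # is @ [i]))) (last_index (is @ [i]))
          (m + 2) (int d - sum_list (is @ [i]))))"
      by (intro Suc.IH) (use Suc.prems i in \<open>simp_all add: last\<close>)
    moreover have "int d - sum_list (is @ [i]) = ?s - i"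
      by simp
    ultimately show "nested_sum d k ?F m (is @ [i]) =
        int (card (coprime_partitions (gcd (Gcd (set (int d # is))) i) i (m + 2) (?s - i)))"
      by (simp only: Gcd_eq last)
  qed
  also have "\<dots> = int (card (coprime_partitions (Gcd (set (int d # is))) (last_index is)
      (Suc m + 2) ?s))"
    using card_coprime_partitions_Suc [of "last_index is" "Gcd (set (int d # is))" "m + 2" ?s]
      Suc.prems by simp
  finally show ?case .
qed

section \<open>Sorting partitions by the greatest common divisor of their parts\<close>

lemma sorted_map_mult_iff:
  fixes q :: int
  assumes "q > 0"
  shows "sorted (map ((*) q) ys) \<longleftrightarrow> sorted ys"
  using assms by (auto simp: sorted_iff_nth_mono)

lemma card_bounded_partitions_Gcd:
  fixes q d :: int
  assumes "q > 0"
  shows "card {ys \<in> bounded_partitions 1 k (q * d). Gcd (set ys) = q} =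
    card (coprime_partitions d 1 k d)"
proof (rule sym, rule bij_betw_same_card [OF bij_betw_byWitness
    [where f = "map ((*) q)" and f' = "map (\<lambda>y. y div q)"]])
  have ge_1: "1 \<le> q * y \<longleftrightarrow> 1 \<le> y" for y
    using assms by (smt (verit) zero_less_mult_iff)
  have scale_mem: "map ((*) q) ys \<in> bounded_partitions 1 k (q * d) \<longleftrightarrow> ys \<in> bounded_partitions 1 k d"
    for ys
    using assms by (auto simp: bounded_partitions_def sorted_map_mult_iff sum_list_const_mult ge_1)
  have Gcd_scale: "Gcd (set (map ((*) q) ys)) = q * Gcd (set ys)" for ys
    using assms by (simp add: Gcd_mult abs_mult)
  \<comment> \<open>The greatest common divisor of the parts divides their sum \<open>d\<close>.\<close>
  have coprime_iff: "coprime d (Gcd (set ys)) \<longleftrightarrow> Gcd (set ys) = 1"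
    if "ys \<in> bounded_partitions 1 k d" for ys
  proof -
    have "Gcd (set ys) dvd d"
      using that Gcd_dvd_sum_list [of ys] by (simp add: bounded_partitions_def)
    then show ?thesis
      by (simp add: coprime_iff_gcd_eq_1 gcd_proj2_iff)
  qed
  have unscale: "map ((*) q) (map (\<lambda>y. y div q) zs) = zs" if "Gcd (set zs) = q" for zs
  proof -
    have "q dvd z" if "z \<in> set zs" for z
      using that \<open>Gcd (set zs) = q\<close> by auto
    then show ?thesis
      by (simp add: map_idI)
  qed
  show "\<forall>ys\<in>coprime_partitions d 1 k d. map (\<lambda>y. y div q) (map ((*) q) ys) = ys"
    using assms by (simp add: o_def)
  show "\<forall>zs\<in>{ys \<in> bounded_partitions 1 k (q * d). Gcd (set ys) = q}.
      map ((*) q) (map (\<lambda>y. y div q) zs) = zs"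
    using unscale by blast
  show "map ((*) q) ` coprime_partitions d 1 k d
      \<subseteq> {ys \<in> bounded_partitions 1 k (q * d). Gcd (set ys) = q}"
  proof (rule image_subsetI)
    fix ys assume ys: "ys \<in> coprime_partitions d 1 k d"
    then have "Gcd (set ys) = 1" "ys \<in> bounded_partitions 1 k d"
      using coprime_iff by (auto simp: coprime_partitions_def)
    then show "map ((*) q) ys \<in> {ys \<in> bounded_partitions 1 k (q * d). Gcd (set ys) = q}"
      using scale_mem Gcd_scale [of ys] by simp
  qed
  show "map (\<lambda>y. y div q) ` {ys \<in> bounded_partitions 1 k (q * d). Gcd (set ys) = q}
      \<subseteq> coprime_partitions d 1 k d"
  proof (rule image_subsetI)
    fix zs assume zs: "zs \<in> {ys \<in> bounded_partitions 1 k (q * d). Gcd (set ys) = q}"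
    define ys where "ys = map (\<lambda>y. y div q) zs"
    have zs_eq: "zs = map ((*) q) ys"
      using zs unscale [of zs] by (simp add: ys_def)
    have "ys \<in> bounded_partitions 1 k d"
      using zs scale_mem by (simp add: zs_eq)
    moreover have "q * Gcd (set ys) = q"
      using zs Gcd_scale [of ys] by (simp add: zs_eq)
    ultimately show "map (\<lambda>y. y div q) zs \<in> coprime_partitions d 1 k d"
      using assms coprime_iff by (auto simp: coprime_partitions_def simp flip: ys_def)
  qed
qed

lemma card_bounded_partitions_eq_sum_divisors:
  assumes "n > 0"
  shows "card (bounded_partitions 1 k (int n)) =
    (\<Sum>d | d dvd n. card (coprime_partitions (int d) 1 k (int d)))"
proof -
  let ?A = "\<lambda>q. {ys \<in> bounded_partitions 1 k (int n). Gcd (set ys) = int q}"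
  have "bounded_partitions 1 k (int n) \<subseteq> (\<Union>q\<in>{q. q dvd n}. ?A q)"
  proof
    fix ys assume ys: "ys \<in> bounded_partitions 1 k (int n)"
    then have "Gcd (set ys) dvd int n"
      using Gcd_dvd_sum_list [of ys] by (simp add: bounded_partitions_def)
    moreover have "Gcd (set ys) = int (nat (Gcd (set ys)))"
      by simp
    ultimately show "ys \<in> (\<Union>q\<in>{q. q dvd n}. ?A q)"
      using ys by (metis (mono_tags, lifting) UN_I int_dvd_int_iff mem_Collect_eq)
  qed
  then have "bounded_partitions 1 k (int n) = (\<Union>q\<in>{q. q dvd n}. ?A q)"
    by auto
  also have "card \<dots> = (\<Sum>q | q dvd n. card (?A q))"
    using assms finite_bounded_partitions [of 1 k "int n"] by (subst card_UN_disjoint) auto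
  also have "\<dots> = (\<Sum>d | d dvd n. card (coprime_partitions (int d) 1 k (int d)))"
  proof (rule sum.reindex_bij_witness [where i = "\<lambda>d. n div d" and j = "\<lambda>q. n div q"])
    fix q assume "q \<in> {q. q dvd n}"
    then have "q > 0" and n_eq: "int n = int q * int (n div q)"
      using assms by (auto intro: Nat.gr0I simp flip: of_nat_mult)
    then show "card (coprime_partitions (int (n div q)) 1 k (int (n div q))) = card (?A q)"
      using card_bounded_partitions_Gcd [of "int q" k "int (n div q)"] by simp
  qed (use assms in auto)
  finally show ?thesis .
qed

section \<open>The partition numbers\<close>

lemma num_partitions_eq_card_bounded_partitions:
  "num_partitions n k = card (bounded_partitions 1 k (int n))"
  unfolding num_partitions_def
proof (rule bij_betw_same_card [OF bij_betw_byWitness])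
  let ?f = "\<lambda>M. map int (sorted_list_of_multiset M)"
  let ?g = "\<lambda>ys. mset (map nat ys)"
  have sum_int: "sum_list (map int xs) = int (sum_list xs)" for xs
    by (induction xs) auto
  show "\<forall>M\<in>partitions_into n k. ?g (?f M) = M"
    by (simp add: o_def)
  have inv: "map int (map nat ys) = ys" and sorted: "sorted (map nat ys)"
    if "ys \<in> bounded_partitions 1 k (int n)" for ys
  proof -
    show "map int (map nat ys) = ys"
      using that by (auto simp: bounded_partitions_def intro!: map_idI)
    show "sorted (map nat ys)"
      using that by (auto simp: bounded_partitions_def sorted_iff_nth_mono nat_mono)
  qed
  show "\<forall>ys\<in>bounded_partitions 1 k (int n). ?f (?g ys) = ys"
    using inv sorted by (simp add: sorted_sort_id del: map_map mset_map)
  show "?f ` partitions_into n k \<subseteq> bounded_partitions 1 k (int n)"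
  proof (rule image_subsetI)
    fix M assume M: "M \<in> partitions_into n k"
    have "size (mset (sorted_list_of_multiset M)) = k"
      "sum_mset (mset (sorted_list_of_multiset M)) = n"
      using M by (simp_all add: partitions_into_def)
    moreover have "1 \<le> x" if "x \<in># M" for x
      using that M by (cases x) (auto simp: partitions_into_def)
    moreover have "sorted (?f M)"
      by (auto simp: sorted_map intro: sorted_wrt_mono_rel)
    ultimately show "?f M \<in> bounded_partitions 1 k (int n)"
      by (auto simp: bounded_partitions_def sum_int sum_mset_sum_list
        simp del: mset_sorted_list_of_multiset)
  qed
  show "?g ` bounded_partitions 1 k (int n) \<subseteq> partitions_into n k"
  proof (rule image_subsetI)
    fix ys assume ys: "ys \<in> bounded_partitions 1 k (int n)"
    have "int (sum_list (map nat ys)) = int n"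
      using ys inv [OF ys] sum_int [of "map nat ys"] by (simp add: bounded_partitions_def)
    then have "sum_mset (?g ys) = n"
      by (simp only: sum_mset_sum_list of_nat_eq_iff)
    then show "?g ys \<in> partitions_into n k"
      using ys by (auto simp: partitions_into_def bounded_partitions_def)
  qed
qed

theorem theorem6:
  fixes n k :: nat
  assumes "n > 0" and "k \<ge> 2"
  shows "int (num_partitions n k) =
    (\<Sum>d | d dvd n.
       nested_sum d k
         (\<lambda>is. \<Sum>c | int c dvd Gcd (set (int d # is)).
            moebius c * ((int d - sum_list is) div (2 * int c) - (last_index is - 1) div int c))
         (k - 2) [])"
proof -
  have "nested_sum d k
         (\<lambda>is. \<Sum>c | int c dvd Gcd (set (int d # is)).
            moebius c * ((int d - sum_list is) div (2 * int c) - (last_index is - 1) div int c))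
         (k - 2) [] = int (card (coprime_partitions (int d) 1 k (int d)))" if "d dvd n" for d
  proof -
    have "d > 0" using that assms by (auto intro: Nat.gr0I)
    moreover have "k - 2 + 2 = k" using assms by simp
    ultimately show ?thesis
      using nested_sum_eq_card [of d "[]" "k - 2" k] by (simp add: last_index_def)
  qed
  then show ?thesis
    using assms
    by (simp add: num_partitions_eq_card_bounded_partitions card_bounded_partitions_eq_sum_divisors)
qed

end
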